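(* Let $K\subset\mathbb{R}^d$ be a convex body. Then $$\frac{R(K,\mathbb{B}_2)}{R_1(K,\mathbb{B}_2)} \le \min\left\{\sqrt{\frac{2d}{d+1}},\ \frac{2s(K)}{s(K)+1}\right\}.$$ This bound is best possible in the sense that for every $\sigma\in[1,d]$ there is a convex body $K\subset\mathbb{R}^d$ with $s(K)=\sigma$ for which the inequality is tight (holds with equality).
   Context: A convex body in $\mathbb{R}^d$ is a non-empty compact convex set. $\mathbb{B}_2=\{x\in\mathbb{R}^d:\|x\|_2\le 1\}$ is the Euclidean unit ball. For non-empty closed convex $K,C\subset\mathbb{R}^d$: - $R(K,C) := \inf\{\rho\ge 0 : \exists c\in\mathbb{R}^d \text{ such that } K\subset c+\rho C\}$ (so $R(K,\mathbb{B}_2)$ is the Euclidean circumradius). - $R_1(K,C) := \sup\{R([x,y],C) : x,y\in K\}$, where $[x,y]=\mathrm{conv}\{x,y\}$ (so $R_1(K,\mathbb{B}_2)$ is half the Euclidean diameter). - Minkowski asymmetry: $s(K) := R(-K,K)$, where $-K=\{-x:x\in K\}$. Convention: ratios of the form $0/0$ or $\infty/\infty$ are taken to be $1$.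
   Formalization: The inequality is stated for convex bodies that are not a single point: for a singleton the left side is 0/0 = 1 by convention, while s(K) = 0 makes the right side 0, so the claim fails there. *)

theory Defs
  imports "HOL-Analysis.Analysis"
begin

definition convex_body :: "'a::euclidean_space set \<Rightarrow> bool" where
  "convex_body K \<longleftrightarrow> K \<noteq> {} \<and> compact K \<and> convex K"

text \<open>
  The functionals are extended-real valued: if no dilate of \<open>C\<close> covers \<open>K\<close>, the infimum
  ranges over the empty set and the value is \<open>\<infinity>\<close>.
\<close>

definition radius :: "'a::euclidean_space set \<Rightarrow> 'a set \<Rightarrow> ereal" where
  "radius K C = Inf {ereal \<rho> | \<rho>. 0 \<le> \<rho> \<and> (\<exists>c. K \<subseteq> (\<lambda>x. c + \<rho> *\<^sub>R x) ` C)}"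

definition radius1 :: "'a::euclidean_space set \<Rightarrow> 'a set \<Rightarrow> ereal" where
  "radius1 K C = Sup {radius (closed_segment x y) C | x y. x \<in> K \<and> y \<in> K}"

definition minkowski_asymmetry :: "'a::euclidean_space set \<Rightarrow> ereal" where
  "minkowski_asymmetry K = radius (uminus ` K) K"

text \<open>
  Quotient with the convention that \<open>0/0\<close> and \<open>\<infinity>/\<infinity>\<close> are \<open>1\<close>; the division of
  \<^typ>\<open>ereal\<close> would give \<open>0\<close> in both cases.

  A singleton has \<open>radius = radius1 = 0\<close>, hence quotient \<open>1\<close>, but Minkowski asymmetry \<open>0\<close>
  (take \<open>\<rho> = 0\<close>). An upper bound of the form \<open>2 * s / (s + 1)\<close> on the quotient therefore
  fails for singletons, which have to be excluded.
\<close>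

definition ratio :: "ereal \<Rightarrow> ereal \<Rightarrow> ereal" where
  "ratio a b = (if (a = 0 \<and> b = 0) \<or> (a = \<infinity> \<and> b = \<infinity>) then 1 else a / b)"

end

theory Submission
  imports Defs
begin

text \<open>
  With respect to the Euclidean ball, \<open>radius1\<close> is half the diameter \<open>D\<close>, so for a body of
  circumradius \<open>R\<close> the quotient in question is \<open>2 * R / D\<close>. Two independent estimates bound it;
  \<open>d\<close> is the dimension and \<open>s\<close> the Minkowski asymmetry.

  The first is Jung's theorem. The circumcentre is a convex combination of at most \<open>d + 1\<close> points
  of \<open>K\<close> that lie on the circumsphere (\<open>circumcenter_in_hull_contacts\<close> and Caratheodory's
  theorem). Averaging the squared distances from one of these points to the others, with the weights
  of the combination, gives \<open>2 * R\<^sup>2\<close>; it is also at most \<open>D\<^sup>2\<close> times one minus the weight of the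
  point. Summing over the points gives the bound by \<open>d\<close>.

  The second uses a reflection. If \<open>-K\<close> lies in a translate of \<open>\<rho> K\<close>, then there is a point \<open>p\<close>
  such that every \<open>x\<close> in \<open>K\<close> has a partner \<open>y\<close> in \<open>K\<close> on the opposite side of \<open>p\<close> with
  \<open>x - p = -\<rho> (y - p)\<close>. The segment from \<open>x\<close> to \<open>y\<close> is \<open>1 + 1/\<rho>\<close> times as long as the one
  from \<open>x\<close> to \<open>p\<close>, so \<open>K\<close> lies in a ball of radius \<open>\<rho> D / (\<rho> + 1)\<close> around \<open>p\<close>.

  For sharpness, let \<open>T\<close> be a regular simplex inscribed in the unit sphere and let \<open>K\<close> be the convex
  hull of \<open>T\<close> and \<open>-(1/\<sigma>) T\<close>. Its circumradius is that of \<open>T\<close>, namely \<open>1\<close>. Its diameter is at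
  most the larger of the edge length of \<open>T\<close> and the length \<open>1 + 1/\<sigma>\<close> of the segment from a vertex
  through the centre to its scaled reflection; these two numbers correspond exactly to the two terms
  of the minimum. Its asymmetry is \<open>\<sigma>\<close>, where the lower bound comes from adding up the
  inequalities between support functions in the directions opposite to the vertices of \<open>T\<close>.
\<close>

section \<open>Circumradius and diameter\<close>

lemma cball_eq_affinity:
  fixes c :: "'a::real_normed_vector"
  assumes "0 \<le> \<rho>"
  shows "(\<lambda>x. c + \<rho> *\<^sub>R x) ` cball 0 1 = cball c \<rho>"
proof (cases "\<rho> = 0")
  case True
  have "(0::'a) \<in> cball 0 1" by simp
  with True show ?thesis by (auto simp: image_constant_conv)
next
  case False
  with assms have "\<rho> > 0" by simp
  show ?thesis
  proof (intro equalityI subsetI)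
    fix y assume "y \<in> (\<lambda>x. c + \<rho> *\<^sub>R x) ` cball 0 1"
    then show "y \<in> cball c \<rho>"
      using \<open>\<rho> > 0\<close> by (auto simp: dist_norm mult_left_le)
  next
    fix y assume "y \<in> cball c \<rho>"
    then have "norm ((1/\<rho>) *\<^sub>R (y - c)) \<le> 1"
      using \<open>\<rho> > 0\<close> by (auto simp: dist_norm norm_minus_commute divide_simps)
    moreover have "y = c + \<rho> *\<^sub>R ((1/\<rho>) *\<^sub>R (y - c))"
      using \<open>\<rho> > 0\<close> by simp
    ultimately show "y \<in> (\<lambda>x. c + \<rho> *\<^sub>R x) ` cball 0 1"
      by (metis (no_types) image_eqI mem_cball_0)
  qed
qed

lemma radius_cball:
  "radius K (cball 0 1) = Inf {ereal \<rho> | \<rho>. 0 \<le> \<rho> \<and> (\<exists>c. K \<subseteq> cball c \<rho>)}"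
  unfolding radius_def by (simp add: cball_eq_affinity cong: conj_cong)

lemma circumradius_le:
  assumes "K \<noteq> {}" "K \<subseteq> cball c r"
  shows "radius K (cball 0 1) \<le> ereal r"
proof -
  have "0 \<le> r" using assms by (metis all_not_in_conv cball_eq_empty not_less subset_empty)
  then show ?thesis unfolding radius_cball using assms by (intro Inf_lower) blast
qed

lemma circumradius_ge:
  assumes "\<And>c \<rho>. 0 \<le> \<rho> \<Longrightarrow> K \<subseteq> cball c \<rho> \<Longrightarrow> r \<le> \<rho>"
  shows "ereal r \<le> radius K (cball 0 1)"
  unfolding radius_cball using assms by (intro Inf_greatest) auto

text \<open>
  The pairs of a centre and a radius of a ball containing \<open>K\<close> form a closed set. Balls that do
  not exceed the diameter of \<open>K\<close> have their centres within that distance of any point of \<open>K\<close>, so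
  the search for a smallest radius takes place in a compact set.
\<close>
lemma circumball_exists:
  fixes K :: "'a::euclidean_space set"
  assumes "compact K" "K \<noteq> {}"
  obtains c R where "0 \<le> R" "K \<subseteq> cball c R" "radius K (cball 0 1) = ereal R"
proof -
  define F where "F = (\<Inter>x\<in>K. {(c, \<rho>). dist c x \<le> (\<rho>::real)})"
  obtain x0 where x0: "x0 \<in> K" using assms by blast
  define r0 where "r0 = diameter K"
  have r0: "K \<subseteq> cball x0 r0" "0 \<le> r0"
    using x0 diameter_bounded_bound diameter_ge_0 compact_imp_bounded[OF assms(1)]
    by (auto simp: r0_def)
  have F: "(c, \<rho>) \<in> F \<longleftrightarrow> K \<subseteq> cball c \<rho>" for c \<rho>
    by (auto simp: F_def)
  have "closed {(c, \<rho>). dist c x \<le> (\<rho>::real)}" for x :: 'a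
    unfolding case_prod_beta by (intro closed_Collect_le continuous_intros)
  then have "closed F" unfolding F_def by blast
  then have "compact (F \<inter> (cball x0 r0 \<times> {0..r0}))"
    by (intro closed_Int_compact compact_Times compact_cball compact_Icc)
  moreover have "(x0, r0) \<in> F \<inter> (cball x0 r0 \<times> {0..r0})"
    using r0 F by auto
  ultimately obtain q where q: "q \<in> F \<inter> (cball x0 r0 \<times> {0..r0})"
    and qmin: "\<And>y. y \<in> F \<inter> (cball x0 r0 \<times> {0..r0}) \<Longrightarrow> snd q \<le> snd y"
    using continuous_attains_inf[of "F \<inter> (cball x0 r0 \<times> {0..r0})" snd]
      continuous_on_snd[OF continuous_on_id] by blast
  obtain c R where cR: "q = (c, R)" by force
  have KR: "K \<subseteq> cball c R" "0 \<le> R" "R \<le> r0" using q F cR by auto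
  have "ereal R \<le> radius K (cball 0 1)"
  proof (rule circumradius_ge)
    fix c' \<rho> assume *: "0 \<le> \<rho>" "K \<subseteq> cball c' \<rho>"
    show "R \<le> \<rho>"
    proof (cases "\<rho> \<le> r0")
      case True
      have "dist c' x0 \<le> \<rho>" using * x0 by auto
      then have "(c', \<rho>) \<in> F \<inter> (cball x0 r0 \<times> {0..r0})"
        using * True F by (auto simp: dist_commute)
      then show ?thesis using qmin cR by fastforce
    qed (use KR in simp)
  qed
  then have "radius K (cball 0 1) = ereal R"
    using circumradius_le[OF assms(2) KR(1)] by simp
  then show ?thesis using that KR by blast
qed

lemma circumradius_segment:
  fixes x y :: "'a::euclidean_space"
  shows "radius (closed_segment x y) (cball 0 1) = ereal (dist x y / 2)"
proof (rule antisym)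
  have "closed_segment x y \<subseteq> cball (midpoint x y) (dist x y / 2)"
    by (intro closed_segment_subset) (auto simp: dist_midpoint)
  then show "radius (closed_segment x y) (cball 0 1) \<le> ereal (dist x y / 2)"
    by (intro circumradius_le) auto
  show "ereal (dist x y / 2) \<le> radius (closed_segment x y) (cball 0 1)"
  proof (rule circumradius_ge)
    fix c \<rho> assume "closed_segment x y \<subseteq> cball c \<rho>"
    then have "dist c x \<le> \<rho>" "dist c y \<le> \<rho>" by (auto simp: subset_iff)
    then show "dist x y / 2 \<le> \<rho>" using dist_triangle3[of x y c] by simp
  qed
qed

lemma radius1_eq_half_diameter:
  fixes K :: "'a::euclidean_space set"
  assumes "compact K" "K \<noteq> {}"
  shows "radius1 K (cball 0 1) = ereal (diameter K / 2)"
proof (rule antisym)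
  show "radius1 K (cball 0 1) \<le> ereal (diameter K / 2)"
    unfolding radius1_def circumradius_segment
    using diameter_bounded_bound[OF compact_imp_bounded[OF assms(1)]]
    by (intro Sup_least) auto
  obtain x y where "x \<in> K" "y \<in> K" "dist x y = diameter K"
    using diameter_compact_attained[OF assms] by blast
  then show "ereal (diameter K / 2) \<le> radius1 K (cball 0 1)"
    unfolding radius1_def circumradius_segment by (intro Sup_upper) force
qed

lemma diameter_pos:
  assumes "bounded K" "x \<in> K" "y \<in> K" "x \<noteq> y"
  shows "0 < diameter K"
  using diameter_bounded_bound[OF assms(1-3)] assms(4) by (metis dist_pos_lt less_le_trans)

lemma ratio_eq:
  fixes K :: "'a::euclidean_space set"
  assumes "compact K" "K \<noteq> {}" "0 < diameter K" "radius K (cball 0 1) = ereal R"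
  shows "ratio (radius K (cball 0 1)) (radius1 K (cball 0 1)) = ereal (2 * R / diameter K)"
  using assms by (simp add: radius1_eq_half_diameter ratio_def)

section \<open>Jung's theorem\<close>

text \<open>
  Otherwise a hyperplane separates the centre \<open>c\<close> strictly from all contact points, and moving \<open>c\<close>
  a little towards them by \<open>t *\<^sub>R u\<close> brings \<open>K\<close> into a smaller ball. Points of \<open>K\<close> beyond the
  hyperplane come closer to the centre. The points on the near side form a compact set that misses
  the sphere, so their distances to \<open>c\<close> stay below some \<open>R' < R\<close>, which leaves room for the move.
\<close>
lemma circumcenter_in_hull_contacts:
  fixes K :: "'a::euclidean_space set"
  assumes "compact K" "K \<noteq> {}" "K \<subseteq> cball c R" "radius K (cball 0 1) = ereal R"
  shows "c \<in> convex hull (K \<inter> sphere c R)"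
proof (rule ccontr)
  assume contr: "c \<notin> convex hull (K \<inter> sphere c R)"
  have R: "0 \<le> R" using assms by (metis all_not_in_conv cball_eq_empty not_less subset_empty)
  have "closed (convex hull (K \<inter> sphere c R))"
    using assms by (intro compact_imp_closed compact_convex_hull compact_Int_closed) auto
  then obtain u b where ub: "u \<bullet> c < b" "\<And>x. x \<in> convex hull (K \<inter> sphere c R) \<Longrightarrow> b < u \<bullet> x"
    using separating_hyperplane_closed_point[OF convex_convex_hull _ contr] by blast
  define \<beta> where "\<beta> = b - u \<bullet> c"
  have "\<beta> > 0" using ub by (simp add: \<beta>_def)
  define K' where "K' = K \<inter> {x. u \<bullet> x \<le> b}"
  have K': "dist c x < R" if "x \<in> K'" for x
  proof -
    have "x \<in> K" "u \<bullet> x \<le> b" using that by (auto simp: K'_def)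
    then have "dist c x \<noteq> R" using ub(2)[of x] hull_inc[of x "K \<inter> sphere c R" convex] by auto
    then show ?thesis using \<open>x \<in> K\<close> assms(3) by force
  qed
  have "compact K'" unfolding K'_def
    using assms by (intro compact_Int_closed closed_halfspace_le)
  obtain R' where R': "R' < R" "\<And>x. x \<in> K' \<Longrightarrow> dist c x \<le> R'"
  proof (cases "K' = {}")
    case True
    then show ?thesis using that[of "R - 1"] by auto
  next
    case False
    have "continuous_on K' (dist c)" by (intro continuous_intros)
    then obtain z where "z \<in> K'" "\<And>x. x \<in> K' \<Longrightarrow> dist c x \<le> dist c z"
      using continuous_attains_sup[OF \<open>compact K'\<close> False] by blast
    then show ?thesis using that[of "dist c z"] K' by blast
  qed
  \<comment> \<open>The first bound on the step keeps the near points within \<open>(R + R') / 2\<close>; the second makes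
    the quadratic term in the squared distance of the far points at most half of the linear gain.\<close>
  define t where "t = min ((R - R') / (2 * (norm u + 1))) (\<beta> / ((norm u)\<^sup>2 + 1))"
  have nu: "norm u + 1 > 0" "(norm u)\<^sup>2 + 1 > 0"
    by (auto intro: add_nonneg_pos)
  have "t > 0" using R' \<open>\<beta> > 0\<close> nu by (simp add: t_def)
  have "t \<le> (R - R') / (2 * (norm u + 1))" by (simp add: t_def)
  then have "t * (norm u + 1) \<le> (R - R') / 2"
    using nu by (simp add: field_simps)
  then have t1: "t * norm u \<le> (R - R') / 2"
    using \<open>t > 0\<close> by (simp add: algebra_simps)
  have "t \<le> \<beta> / ((norm u)\<^sup>2 + 1)" by (simp add: t_def)
  then have "t * ((norm u)\<^sup>2 + 1) \<le> \<beta>"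
    using nu by (simp add: pos_le_divide_eq)
  then have t2: "t * (norm u)\<^sup>2 \<le> \<beta>"
    using \<open>t > 0\<close> by (simp add: algebra_simps)
  define r where "r = max ((R + R') / 2) (sqrt (R\<^sup>2 - t * \<beta>))"
  have "sqrt (R\<^sup>2 - t * \<beta>) < sqrt (R\<^sup>2)"
    using \<open>t > 0\<close> \<open>\<beta> > 0\<close> by (intro real_sqrt_less_mono) simp
  then have "r < R" using R R'(1) by (simp add: r_def)
  have "K \<subseteq> cball (c + t *\<^sub>R u) r"
  proof
    fix x assume "x \<in> K"
    show "x \<in> cball (c + t *\<^sub>R u) r"
    proof (cases "u \<bullet> x \<le> b")
      case True
      then have "dist c x \<le> R'" using R' \<open>x \<in> K\<close> by (simp add: K'_def)
      moreover have "dist (c + t *\<^sub>R u) c = t * norm u"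
        using \<open>t > 0\<close> by (simp add: dist_norm)
      ultimately have "dist (c + t *\<^sub>R u) x \<le> (R + R') / 2"
        using t1 dist_triangle[of "c + t *\<^sub>R u" x c] by argo
      then show ?thesis unfolding mem_cball r_def by (rule max.coboundedI1)
    next
      case False
      then have *: "u \<bullet> (x - c) \<ge> \<beta>" by (simp add: \<beta>_def inner_diff_right)
      have "norm (x - c) \<le> R" using assms(3) \<open>x \<in> K\<close>
        by (metis dist_commute dist_norm mem_cball subsetD)
      then have 1: "(norm (x - c))\<^sup>2 \<le> R\<^sup>2" by (intro power_mono) auto
      have "(norm ((x - c) - t *\<^sub>R u))\<^sup>2
          = (norm (x - c))\<^sup>2 - 2 * t * (u \<bullet> (x - c)) + t * (t * (norm u)\<^sup>2)"
        unfolding power2_norm_eq_inner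
        by (simp add: inner_diff_left inner_diff_right inner_commute algebra_simps power2_eq_square)
      also have "\<dots> \<le> R\<^sup>2 - 2 * t * \<beta> + t * \<beta>"
        using 1 * t2 \<open>t > 0\<close> by (intro add_mono diff_mono mult_left_mono) auto
      finally have "norm ((x - c) - t *\<^sub>R u) \<le> sqrt (R\<^sup>2 - t * \<beta>)"
        by (intro real_le_rsqrt) (simp add: algebra_simps)
      moreover have "dist (c + t *\<^sub>R u) x = norm ((x - c) - t *\<^sub>R u)"
        by (subst dist_commute) (simp add: dist_norm algebra_simps)
      ultimately show ?thesis by (simp add: r_def)
    qed
  qed
  from circumradius_le[OF assms(2) this] show False
    using assms(4) \<open>r < R\<close> by simp
qed

text \<open>
  The usual form \<open>R \<le> D * sqrt (d / (2 * (d + 1)))\<close>, squared and cleared of denominators.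
\<close>
theorem Jung:
  fixes K :: "'a::euclidean_space set"
  assumes "compact K" "K \<noteq> {}" "radius K (cball 0 1) = ereal R"
  shows "2 * R\<^sup>2 * (real DIM('a) + 1) \<le> (diameter K)\<^sup>2 * real DIM('a)"
proof -
  obtain c where cR: "K \<subseteq> cball c R"
    using circumball_exists[OF assms(1,2)] assms(3) by (metis ereal.inject)
  obtain S where S: "finite S" "S \<subseteq> K \<inter> sphere c R" "card S \<le> DIM('a) + 1" "c \<in> convex hull S"
    using circumcenter_in_hull_contacts[OF assms(1,2) cR assms(3)]
    unfolding caratheodory[of "K \<inter> sphere c R"] by blast
  then obtain l where l: "\<And>x. x \<in> S \<Longrightarrow> 0 \<le> l x" "sum l S = 1" "(\<Sum>x\<in>S. l x *\<^sub>R x) = c"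
    unfolding convex_hull_finite[OF S(1)] by blast
  define D where "D = diameter K"
  have nrm: "(norm (x - c))\<^sup>2 = R\<^sup>2" if "x \<in> S" for x
    using that S(2) by (auto simp: dist_norm norm_minus_commute)
  have zero: "(\<Sum>x\<in>S. l x *\<^sub>R (x - c)) = 0"
    by (simp add: scaleR_diff_right sum_subtractf l flip: scaleR_left.sum)
  \<comment> \<open>Expanding around the circumcentre, the mixed terms cancel in the weighted mean of the squared
    distances to \<open>y\<close>, and \<open>y\<close> itself contributes nothing to that mean.\<close>
  have each: "2 * R\<^sup>2 \<le> (1 - l y) * D\<^sup>2" if "y \<in> S" for y
  proof -
    have "(\<Sum>x\<in>S. l x * (dist x y)\<^sup>2) = (\<Sum>x\<in>S. l x * (2 * R\<^sup>2) - 2 * (l x *\<^sub>R (x - c) \<bullet> (y - c)))"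
    proof (rule sum.cong)
      fix x assume "x \<in> S"
      have "(dist x y)\<^sup>2 = (norm ((x - c) - (y - c)))\<^sup>2" by (simp add: dist_norm)
      also have "\<dots> = (norm (x - c))\<^sup>2 + (norm (y - c))\<^sup>2 - 2 * ((x - c) \<bullet> (y - c))"
        by (simp add: power2_norm_eq_inner inner_diff_left inner_diff_right inner_commute)
      finally have "(dist x y)\<^sup>2 = 2 * R\<^sup>2 - 2 * ((x - c) \<bullet> (y - c))"
        using nrm \<open>x \<in> S\<close> that by simp
      then show "l x * (dist x y)\<^sup>2 = l x * (2 * R\<^sup>2) - 2 * (l x *\<^sub>R (x - c) \<bullet> (y - c))"
        by (simp only: inner_scaleR_left) (simp add: right_diff_distrib)
    qed simp
    also have "\<dots> = sum l S * (2 * R\<^sup>2) - 2 * ((\<Sum>x\<in>S. l x *\<^sub>R (x - c)) \<bullet> (y - c))"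
      by (simp only: sum_subtractf sum_distrib_right sum_distrib_left inner_sum_left)
    also have "\<dots> = 2 * R\<^sup>2" by (simp add: zero l(2))
    finally have "2 * R\<^sup>2 = (\<Sum>x\<in>S. l x * (dist x y)\<^sup>2)" by simp
    also have "\<dots> = (\<Sum>x\<in>S - {y}. l x * (dist x y)\<^sup>2)"
      using S(1) that by (subst sum.remove[of S y]) auto
    also have "\<dots> \<le> (\<Sum>x\<in>S - {y}. l x * D\<^sup>2)"
    proof (intro sum_mono mult_left_mono power_mono)
      fix x assume "x \<in> S - {y}"
      then show "dist x y \<le> D" unfolding D_def
        using that S(2) assms(1) by (intro diameter_bounded_bound compact_imp_bounded) auto
    qed (use l in auto)
    also have "\<dots> = (1 - l y) * D\<^sup>2"
      using S(1) that l(2) by (simp add: sum_diff1 flip: sum_distrib_right)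
    finally show ?thesis .
  qed
  define m where "m = real (card S)"
  have "S \<noteq> {}" using l(2) by auto
  then have m: "m > 0" "m \<le> real DIM('a) + 1"
    using S(1,3) by (auto simp: m_def card_gt_0_iff simp flip: of_nat_Suc)
  have "(\<Sum>y\<in>S. 2 * R\<^sup>2) \<le> (\<Sum>y\<in>S. (1 - l y) * D\<^sup>2)"
    by (intro sum_mono each)
  also have "\<dots> = (m - 1) * D\<^sup>2"
    by (simp add: sum_subtractf l(2) m_def flip: sum_distrib_right)
  finally have mD: "m * (2 * R\<^sup>2) \<le> (m - 1) * D\<^sup>2" by (simp add: m_def)
  have RD: "2 * R\<^sup>2 \<le> D\<^sup>2"
  proof -
    have "m * (2 * R\<^sup>2) \<le> m * D\<^sup>2" using mD by (simp add: algebra_simps) 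
       (smt (verit) zero_le_power2)
    then show ?thesis using m(1) by simp
  qed
  \<comment> \<open>The number \<open>m\<close> of contact points may be smaller than \<open>d + 1\<close>; as \<open>2 * R\<^sup>2 \<le> D\<^sup>2\<close>, raising
    it to \<open>d + 1\<close> only weakens the inequality.\<close>
  have "(real DIM('a) + 1 - m) * (2 * R\<^sup>2) \<le> (real DIM('a) + 1 - m) * D\<^sup>2"
    using m RD by (intro mult_left_mono) auto
  then show ?thesis using mD unfolding D_def by (simp add: algebra_simps)
qed

section \<open>The bound by the Minkowski asymmetry\<close>

text \<open>
  Stated without division by \<open>\<rho>\<close>, so that it covers \<open>\<rho> = 0\<close>, where \<open>K\<close> is a single point.
\<close>
lemma circumradius_le_of_reflection:
  fixes K :: "'a::euclidean_space set"
  assumes "compact K" "K \<noteq> {}" "radius K (cball 0 1) = ereal R"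
    and "0 \<le> \<rho>" "uminus ` K \<subseteq> (\<lambda>x. c + \<rho> *\<^sub>R x) ` K"
  shows "(\<rho> + 1) * R \<le> \<rho> * diameter K"
proof -
  \<comment> \<open>The fixed point of \<open>y \<mapsto> - (c + \<rho> *\<^sub>R y)\<close>, the map that sends the partner \<open>y\<close> to \<open>x\<close>.\<close>
  define p where "p = - (1 / (\<rho> + 1)) *\<^sub>R c"
  have c: "c = - (\<rho> + 1) *\<^sub>R p"
    using assms(4) unfolding p_def by (simp del: minus_add_distrib)
  have "K \<subseteq> cball p (\<rho> * diameter K / (\<rho> + 1))"
  proof
    fix x assume "x \<in> K"
    then obtain y where y: "y \<in> K" "- x = c + \<rho> *\<^sub>R y" using assms(5) by blast
    have *: "x - p = - \<rho> *\<^sub>R (y - p)"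
      using arg_cong[OF y(2), of uminus] by (simp add: c algebra_simps)
    have "(\<rho> + 1) *\<^sub>R (x - p) = \<rho> *\<^sub>R (x - p) + (x - p)"
      by (simp add: scaleR_left_distrib)
    also have "\<dots> = \<rho> *\<^sub>R (x - y)" by (subst (2) *) (simp add: algebra_simps)
    finally have "(\<rho> + 1) * norm (x - p) = \<rho> * norm (x - y)"
      using assms(4) by (metis abs_of_nonneg add_nonneg_nonneg norm_scaleR zero_le_one)
    also have "\<dots> \<le> \<rho> * diameter K"
      using assms(4) \<open>x \<in> K\<close> y(1) diameter_bounded_bound[OF compact_imp_bounded[OF assms(1)]]
      by (intro mult_left_mono) (auto simp: dist_norm)
    finally show "x \<in> cball p (\<rho> * diameter K / (\<rho> + 1))"
      using assms(4) by (simp add: dist_norm norm_minus_commute field_simps)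
  qed
  from circumradius_le[OF assms(2) this] assms(3,4) show ?thesis
    by (simp add: field_simps)
qed

text \<open>
  Reflect in a relative interior point \<open>z\<close>: after shrinking by a large factor, the reflected body
  fits into a small ball around \<open>z\<close> inside the affine hull, hence into \<open>K\<close>. The relative
  interior is needed since \<open>K\<close> may have empty interior. Finiteness matters because in
  \<^typ>\<open>ereal\<close> the value \<open>s = \<infinity>\<close> would turn \<open>2 * s / (s + 1)\<close> into \<open>0\<close>.
\<close>
lemma minkowski_asymmetry_finite:
  fixes K :: "'a::euclidean_space set"
  assumes "convex_body K"
  obtains s where "0 \<le> s" "minkowski_asymmetry K = ereal s"
proof -
  have K: "K \<noteq> {}" "compact K" "convex K" using assms by (auto simp: convex_body_def)
  then obtain z e where z: "z \<in> K" "e > 0" "cball z e \<inter> affine hull K \<subseteq> K"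
    by (metis mem_rel_interior_cball rel_interior_eq_empty all_not_in_conv)
  define \<rho> where "\<rho> = diameter K / e + 1"
  have D: "0 \<le> diameter K" using K by (simp add: diameter_ge_0 compact_imp_bounded)
  then have \<rho>: "\<rho> > 0" "diameter K \<le> \<rho> * e" using z by (auto simp: \<rho>_def field_simps add_pos_nonneg)
  have "uminus ` K \<subseteq> (\<lambda>x. - (1 + \<rho>) *\<^sub>R z + \<rho> *\<^sub>R x) ` K"
  proof clarify
    fix x assume x: "x \<in> K"
    define y where "y = (1 + 1/\<rho>) *\<^sub>R z + (- 1/\<rho>) *\<^sub>R x"
    have "y \<in> affine hull K" unfolding y_def
      using x z by (intro mem_affine[OF affine_affine_hull] hull_inc) auto
    moreover have "dist z y \<le> e"
    proof -
      have "z - y = (1/\<rho>) *\<^sub>R (x - z)" by (simp add: y_def algebra_simps)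
      then have "dist z y = dist x z / \<rho>" using \<rho> by (simp add: dist_norm)
      also have "\<dots> \<le> diameter K / \<rho>"
        using \<rho> x z(1) diameter_bounded_bound[OF compact_imp_bounded[OF K(2)]]
        by (intro divide_right_mono) auto
      also have "\<dots> \<le> e" using \<rho> by (simp add: field_simps)
      finally show ?thesis .
    qed
    ultimately have "y \<in> K" using z(3) by auto
    moreover have "- x = - (1 + \<rho>) *\<^sub>R z + \<rho> *\<^sub>R y"
      using \<rho> by (simp add: y_def algebra_simps)
    ultimately show "- x \<in> (\<lambda>x. - (1 + \<rho>) *\<^sub>R z + \<rho> *\<^sub>R x) ` K" by blast
  qed
  then have "minkowski_asymmetry K \<le> ereal \<rho>"
    unfolding minkowski_asymmetry_def radius_def using \<rho> by (intro Inf_lower) force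
  moreover have "0 \<le> minkowski_asymmetry K"
    unfolding minkowski_asymmetry_def radius_def by (intro Inf_greatest) auto
  ultimately show ?thesis using that by (cases "minkowski_asymmetry K") auto
qed

text \<open>
  Solving the reflection inequality for \<open>\<rho>\<close> gives the lower bound \<open>R / (D - R)\<close> for every
  admissible \<open>\<rho>\<close>, hence for the infimum, attained or not.
\<close>
lemma circumradius_le_asymmetry:
  fixes K :: "'a::euclidean_space set"
  assumes "convex_body K" "radius K (cball 0 1) = ereal R" "minkowski_asymmetry K = ereal s"
    and "0 < diameter K"
  shows "2 * R / diameter K \<le> 2 * s / (s + 1)"
proof -
  have K: "K \<noteq> {}" "compact K" using assms by (auto simp: convex_body_def)
  have s0: "0 \<le> s" using minkowski_asymmetry_finite[OF assms(1)] assms(3) by force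
  define D where "D = diameter K"
  have R: "(\<rho> + 1) * R \<le> \<rho> * D" if "0 \<le> \<rho>" "uminus ` K \<subseteq> (\<lambda>x. c + \<rho> *\<^sub>R x) ` K" for \<rho> c
    using circumradius_le_of_reflection[OF K(2,1) assms(2) that] by (simp add: D_def)
  have "\<exists>\<rho> c. 0 \<le> \<rho> \<and> uminus ` K \<subseteq> (\<lambda>x. c + \<rho> *\<^sub>R x) ` K"
  proof (rule ccontr)
    assume "\<not> ?thesis"
    then have "{ereal \<rho> | \<rho>. 0 \<le> \<rho> \<and> (\<exists>c. uminus ` K \<subseteq> (\<lambda>x. c + \<rho> *\<^sub>R x) ` K)} = {}"
      by blast
    then have "minkowski_asymmetry K = Inf {}"
      unfolding minkowski_asymmetry_def radius_def by (rule arg_cong)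
    then show False using assms(3) by (metis Inf_empty PInfty_neq_ereal(1) top_ereal_def)
  qed
  then obtain \<rho>0 where \<rho>0: "0 \<le> \<rho>0" "(\<rho>0 + 1) * R \<le> \<rho>0 * D" using R by blast
  have DR: "R < D"
  proof (rule ccontr)
    assume "\<not> R < D"
    then have "\<rho>0 * D \<le> \<rho>0 * R" using \<rho>0 by (intro mult_left_mono) auto
    then show False using \<rho>0 assms(4) \<open>\<not> R < D\<close> by (simp add: algebra_simps D_def)
  qed
  have "ereal (R / (D - R)) \<le> minkowski_asymmetry K"
    unfolding minkowski_asymmetry_def radius_def
  proof (rule Inf_greatest, clarsimp)
    fix \<rho> c assume "0 \<le> \<rho>" "uminus ` K \<subseteq> (\<lambda>x. c + \<rho> *\<^sub>R x) ` K"
    from R[OF this] show "R / (D - R) \<le> \<rho>" using DR by (simp add: field_simps)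
  qed
  then have "R / (D - R) \<le> s" by (simp add: assms(3))
  then have "(s + 1) * R \<le> s * D" using DR by (simp add: field_simps)
  then show ?thesis using s0 assms(4) by (simp add: D_def field_simps)
qed

section \<open>The extremal bodies\<close>

lemma diameter_convex_hull_le:
  fixes V :: "'a::euclidean_space set"
  assumes "V \<noteq> {}" "\<And>x y. x \<in> V \<Longrightarrow> y \<in> V \<Longrightarrow> dist x y \<le> D"
  shows "diameter (convex hull V) \<le> D"
proof (rule diameter_le)
  have V: "convex hull V \<subseteq> cball x D" if "x \<in> V" for x
    using that assms(2) by (intro hull_minimal) auto
  have "convex hull V \<subseteq> cball x D" if "x \<in> convex hull V" for x
    using that V by (intro hull_minimal) (auto simp: dist_commute subset_iff)
  then show "norm (x - y) \<le> D" if "x \<in> convex hull V" "y \<in> convex hull V" for x y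
    using that by (auto simp: dist_norm subset_iff)
qed (use assms in auto)

text \<open>
  A regular simplex inscribed in the unit sphere, described by the Gram matrix of its vertices.
\<close>
locale regular_simplex =
  fixes p :: "'i::finite \<Rightarrow> 'a::euclidean_space"
  assumes card_vertices: "CARD('i) = DIM('a) + 1"
    and norm_vertex: "norm (p i) = 1"
    and inner_vertices: "i \<noteq> j \<Longrightarrow> p i \<bullet> p j = - 1 / real DIM('a)"
begin

lemma vertex_inner: "p i \<bullet> p j = (if i = j then 1 else - 1 / real DIM('a))"
  using norm_vertex[of i] inner_vertices by (auto simp: norm_eq_1)

lemma sum_vertices: "(\<Sum>i\<in>UNIV. p i) = 0"
proof -
  have "(\<Sum>j\<in>UNIV. p i \<bullet> p j) = 0" for i
  proof -
    have "(\<Sum>j\<in>UNIV. p i \<bullet> p j) = p i \<bullet> p i + (\<Sum>j\<in>UNIV - {i}. p i \<bullet> p j)"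
      by (simp add: sum.remove)
    also have "(\<Sum>j\<in>UNIV - {i}. p i \<bullet> p j) = (\<Sum>j\<in>UNIV - {i}. - 1 / real DIM('a))"
      by (intro sum.cong) (auto simp: vertex_inner)
    also have "\<dots> = - 1" by (simp add: card_Diff_singleton card_vertices)
    finally show ?thesis by (simp add: vertex_inner)
  qed
  then have "(\<Sum>i\<in>UNIV. p i) \<bullet> (\<Sum>i\<in>UNIV. p i) = 0"
    by (subst inner_sum_left) (simp add: inner_sum_right)
  then show ?thesis by simp
qed

text \<open>
  The hull of the simplex \<open>T\<close> and \<open>-(1/\<sigma>) T\<close> interpolates between the centrally symmetric hull of
  \<open>T\<close> and \<open>-T\<close> for \<open>\<sigma> = 1\<close> and \<open>T\<close> itself for \<open>\<sigma> = d\<close>.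
\<close>
definition body :: "real \<Rightarrow> 'a set" where
  "body \<sigma> = convex hull (range p \<union> range (\<lambda>i. - (1 / \<sigma>) *\<^sub>R p i))"

lemma vertex_in_body: "p i \<in> body \<sigma>" "- (1 / \<sigma>) *\<^sub>R p i \<in> body \<sigma>"
  unfolding body_def by (auto intro!: hull_inc)

lemma convex_body_body: "convex_body (body \<sigma>)"
  unfolding convex_body_def
proof (intro conjI)
  show "body \<sigma> \<noteq> {}" using vertex_in_body by blast
  show "compact (body \<sigma>)" unfolding body_def
    by (intro finite_imp_compact_convex_hull) simp
  show "convex (body \<sigma>)" unfolding body_def by simp
qed

lemma body_not_singleton:
  assumes "1 \<le> \<sigma>"
  shows "\<not> is_singleton (body \<sigma>)"
proof
  assume "is_singleton (body \<sigma>)"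
  then have eq: "p i = - (1 / \<sigma>) *\<^sub>R p i" for i
    using vertex_in_body(1)[of i \<sigma>] vertex_in_body(2)[of \<sigma> i] by (metis is_singletonE singletonD)
  have "p i \<bullet> p i = - (1 / \<sigma>) * (p i \<bullet> p i)" for i
    using arg_cong[OF eq[of i], of "\<lambda>x. x \<bullet> p i"] unfolding inner_scaleR_left .
  then have "1 = - (1 / \<sigma>)" by (simp add: vertex_inner)
  moreover have "0 \<le> 1 / \<sigma>" using assms by simp
  ultimately show False by linarith
qed

text \<open>
  No ball smaller than the unit ball contains the vertices: since they sum to \<open>0\<close>, the mean of their
  squared distances to \<open>c\<close> is \<open>1 + (norm c)\<^sup>2\<close>.
\<close>
lemma circumradius_body:
  assumes "1 \<le> \<sigma>"
  shows "radius (body \<sigma>) (cball 0 1) = ereal 1"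
proof (rule antisym)
  have "body \<sigma> \<subseteq> cball 0 1" unfolding body_def
    using assms by (intro hull_minimal) (auto simp: norm_vertex)
  then show "radius (body \<sigma>) (cball 0 1) \<le> ereal 1"
    using convex_body_body by (intro circumradius_le) (auto simp: convex_body_def)
  show "ereal 1 \<le> radius (body \<sigma>) (cball 0 1)"
  proof (rule circumradius_ge)
    fix c \<rho> assume \<rho>: "0 \<le> \<rho>" "body \<sigma> \<subseteq> cball c \<rho>"
    have "(norm (p i - c))\<^sup>2 \<le> \<rho>\<^sup>2" for i
      using \<rho> vertex_in_body(1)[of i \<sigma>]
      by (intro power_mono) (auto simp: dist_norm norm_minus_commute subset_iff)
    moreover have "(norm (p i - c))\<^sup>2 = 1 + (norm c)\<^sup>2 - 2 * (p i \<bullet> c)" for i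
      by (simp add: power2_norm_eq_inner inner_diff_left inner_diff_right inner_commute vertex_inner)
    ultimately have "(\<Sum>i\<in>UNIV. 1 + (norm c)\<^sup>2 - 2 * (p i \<bullet> c)) \<le> (\<Sum>i\<in>(UNIV :: 'i set). \<rho>\<^sup>2)"
      by (intro sum_mono) metis
    also have "(\<Sum>i\<in>UNIV. 1 + (norm c)\<^sup>2 - 2 * (p i \<bullet> c))
        = real CARD('i) * (1 + (norm c)\<^sup>2) - 2 * ((\<Sum>i\<in>UNIV. p i) \<bullet> c)"
      by (simp add: sum_subtractf inner_sum_left flip: sum_distrib_left)
    finally have "1 + (norm c)\<^sup>2 \<le> \<rho>\<^sup>2" by (simp add: sum_vertices card_vertices)
    then have "1\<^sup>2 \<le> \<rho>\<^sup>2" using zero_le_power2[of "norm c"] unfolding one_power2 by linarith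
    then show "1 \<le> \<rho>" using \<rho>(1) by (rule power2_le_imp_le)
  qed
qed

lemma diameter_body_le:
  assumes "1 \<le> \<sigma>"
  shows "diameter (body \<sigma>) \<le> max (sqrt (2 * (real DIM('a) + 1) / real DIM('a))) (1 + 1 / \<sigma>)"
    (is "_ \<le> max ?a ?b")
  unfolding body_def
proof (rule diameter_convex_hull_le)
  have pp: "dist (p i) (p j) \<le> ?a" for i j
  proof -
    have "(dist (p i) (p j))\<^sup>2 = 2 - 2 * (p i \<bullet> p j)"
      by (simp add: dist_norm power2_norm_eq_inner inner_diff_left inner_diff_right inner_commute vertex_inner)
    also have "\<dots> \<le> 2 * (real DIM('a) + 1) / real DIM('a)"
      by (simp add: vertex_inner field_simps)
    finally show ?thesis by (rule real_le_rsqrt)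
  qed
  have nn: "dist (- (1 / \<sigma>) *\<^sub>R p i) (- (1 / \<sigma>) *\<^sub>R p j) \<le> ?a" for i j
  proof -
    have "dist (- (1 / \<sigma>) *\<^sub>R p i) (- (1 / \<sigma>) *\<^sub>R p j) = (1 / \<sigma>) * dist (p i) (p j)"
      using assms by (simp add: dist_norm norm_minus_commute flip: scaleR_diff_right)
    also have "\<dots> \<le> 1 * dist (p i) (p j)"
      using assms by (intro mult_right_mono) auto
    finally show ?thesis using pp[of i j] by simp
  qed
  have pn: "dist (p i) (- (1 / \<sigma>) *\<^sub>R p j) \<le> ?b" for i j
    using norm_triangle_ineq[of "p i" "(1 / \<sigma>) *\<^sub>R p j"] assms
    by (simp add: dist_norm norm_vertex)
  have np: "dist (- (1 / \<sigma>) *\<^sub>R p j) (p i) \<le> ?b" for i j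
    using pn by (simp add: dist_commute)
  fix x y
  assume "x \<in> range p \<union> range (\<lambda>i. - (1 / \<sigma>) *\<^sub>R p i)" "y \<in> range p \<union> range (\<lambda>i. - (1 / \<sigma>) *\<^sub>R p i)"
  then show "dist x y \<le> max ?a ?b"
    by (elim UnE rangeE) (metis max.coboundedI1 max.coboundedI2 pp nn pn np)+
qed simp

text \<open>
  For the upper bound, \<open>-body \<sigma> \<subseteq> \<sigma> body \<sigma>\<close> is checked on the generating points. For the lower
  bound, on \<open>body \<sigma>\<close> the functional given by \<open>p i\<close> is at least \<open>-1/\<sigma>\<close> (this uses \<open>\<sigma> \<le> d\<close>), while
  on the reflected body it takes the value \<open>-1\<close>. An inclusion with factor \<open>\<rho>\<close> and translation \<open>c\<close>
  therefore gives \<open>p i \<bullet> c - \<rho> / \<sigma> \<le> -1\<close>, and the unknown \<open>c\<close> disappears on summing over \<open>i\<close>.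
\<close>
lemma asymmetry_body:
  assumes "1 \<le> \<sigma>" "\<sigma> \<le> real DIM('a)"
  shows "minkowski_asymmetry (body \<sigma>) = ereal \<sigma>"
proof (rule antisym)
  have conv: "convex (body \<sigma>)" by (simp add: body_def)
  have "uminus ` body \<sigma> \<subseteq> (\<lambda>x. 0 + \<sigma> *\<^sub>R x) ` body \<sigma>"
  proof -
    have zero: "0 \<in> body \<sigma>"
    proof -
      have "(1 / (\<sigma> + 1)) *\<^sub>R p i + (\<sigma> / (\<sigma> + 1)) *\<^sub>R (- (1 / \<sigma>) *\<^sub>R p i) \<in> body \<sigma>" for i
        using assms by (intro convexD[OF conv] vertex_in_body) (auto simp: field_simps)
      then show ?thesis using assms by simp
    qed
    have "uminus ` body \<sigma> = convex hull (uminus ` (range p \<union> range (\<lambda>i. - (1 / \<sigma>) *\<^sub>R p i)))"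
      unfolding body_def by (rule convex_hull_linear_image) (simp add: linear_uminus)
    also have "\<dots> \<subseteq> (\<lambda>x. 0 + \<sigma> *\<^sub>R x) ` body \<sigma>"
    proof (rule hull_minimal)
      show "convex ((\<lambda>x. 0 + \<sigma> *\<^sub>R x) ` body \<sigma>)" using conv by (intro convex_affinity)
      have 1: "- p i \<in> (\<lambda>x. 0 + \<sigma> *\<^sub>R x) ` body \<sigma>" for i
        using assms by (intro image_eqI[OF _ vertex_in_body(2)[of \<sigma> i]]) simp
      have 2: "(1 / \<sigma>) *\<^sub>R p i \<in> (\<lambda>x. 0 + \<sigma> *\<^sub>R x) ` body \<sigma>" for i
      proof (rule image_eqI)
        have "(1 / \<sigma>\<^sup>2) *\<^sub>R p i + (1 - 1 / \<sigma>\<^sup>2) *\<^sub>R 0 \<in> body \<sigma>"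
          using assms by (intro convexD[OF conv] vertex_in_body zero) auto
        then show "(1 / \<sigma>\<^sup>2) *\<^sub>R p i \<in> body \<sigma>" by simp
      qed (use assms in \<open>simp add: power2_eq_square\<close>)
      show "uminus ` (range p \<union> range (\<lambda>i. - (1 / \<sigma>) *\<^sub>R p i)) \<subseteq> (\<lambda>x. 0 + \<sigma> *\<^sub>R x) ` body \<sigma>"
        using 1 2 by auto
    qed
    finally show ?thesis .
  qed
  then show "minkowski_asymmetry (body \<sigma>) \<le> ereal \<sigma>"
    unfolding minkowski_asymmetry_def radius_def using assms by (intro Inf_lower) force
  show "ereal \<sigma> \<le> minkowski_asymmetry (body \<sigma>)"
    unfolding minkowski_asymmetry_def radius_def
  proof (rule Inf_greatest, clarsimp)
    fix \<rho> c assume \<rho>: "0 \<le> \<rho>" "uminus ` body \<sigma> \<subseteq> (\<lambda>x. c + \<rho> *\<^sub>R x) ` body \<sigma>"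
    have low: "- (1 / \<sigma>) \<le> p i \<bullet> y" if "y \<in> body \<sigma>" for i y
    proof -
      have "body \<sigma> \<subseteq> {y. p i \<bullet> y \<ge> - (1 / \<sigma>)}" unfolding body_def
      proof (rule hull_minimal)
        have "- (1 / \<sigma>) \<le> - 1 / real DIM('a)" "- (1 / \<sigma>) \<le> 1" "1 / (real DIM('a) * \<sigma>) \<ge> - (1 / \<sigma>)" "- (1 / (real DIM('a) * \<sigma>)) \<le> 1 / \<sigma>"
          using assms by (auto simp: field_simps intro: order_trans[of _ 0])
        then show "range p \<union> range (\<lambda>i. - (1 / \<sigma>) *\<^sub>R p i) \<subseteq> {y. - (1 / \<sigma>) \<le> p i \<bullet> y}"
          by (auto simp: vertex_inner)
      qed (rule convex_halfspace_ge)
      then show ?thesis using that by blast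
    qed
    have "p i \<bullet> c - \<rho> / \<sigma> \<le> - 1" for i
    proof -
      obtain y where y: "y \<in> body \<sigma>" "- p i = c + \<rho> *\<^sub>R y"
        using \<rho>(2) vertex_in_body(1)[of i \<sigma>] by blast
      have "- 1 = p i \<bullet> (- p i)" by (simp add: vertex_inner)
      also have "\<dots> = p i \<bullet> c + \<rho> * (p i \<bullet> y)" by (simp add: y(2) inner_add_right)
      finally show ?thesis using mult_left_mono[OF low[OF y(1)] \<rho>(1), of i] by simp
    qed
    then have "(\<Sum>i\<in>UNIV. p i \<bullet> c - \<rho> / \<sigma>) \<le> (\<Sum>i\<in>(UNIV :: 'i set). - 1)"
      by (intro sum_mono)
    moreover have "(\<Sum>i\<in>UNIV. p i \<bullet> c - \<rho> / \<sigma>) = (\<Sum>i\<in>UNIV. p i) \<bullet> c - real CARD('i) * (\<rho> / \<sigma>)"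
      by (simp add: sum_subtractf inner_sum_left)
    ultimately have "real CARD('i) * 1 \<le> real CARD('i) * (\<rho> / \<sigma>)"
      by (simp add: sum_vertices)
    then have "1 \<le> \<rho> / \<sigma>" by (subst (asm) mult_le_cancel_left_pos) auto
    then show "\<sigma> \<le> \<rho>" using assms by (simp add: field_simps)
  qed
qed

end

text \<open>
  With \<open>e\<close> the all-ones vector, one vertex is \<open>-e / sqrt n\<close> and the others are
  \<open>a *\<^sub>R axis k 1 + b *\<^sub>R e\<close>. The Gram matrix requires \<open>a + n * b = 1 / sqrt n\<close> and
  \<open>2 * a * b + n * b\<^sup>2 = -1 / n\<close>, which together force \<open>a\<^sup>2 = 1 + 1 / n\<close>.
\<close>
lemma regular_simplex_exists:
  obtains p :: "'n::finite option \<Rightarrow> real ^ 'n" where "regular_simplex p"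
proof -
  define n where "n = real CARD('n)"
  have n: "n > 0" by (simp add: n_def)
  define a where "a = sqrt (1 + 1 / n)"
  define b where "b = (1 / sqrt n - a) / n"
  define e :: "real ^ 'n" where "e = (\<chi> i. 1)"
  define p :: "'n option \<Rightarrow> real ^ 'n" where
    "p = (\<lambda>i. case i of None \<Rightarrow> - (1 / sqrt n) *\<^sub>R e | Some k \<Rightarrow> a *\<^sub>R axis k 1 + b *\<^sub>R e)"
  have a2: "a * a = 1 + 1 / n" using n by (simp add: a_def)
  have s2: "1 / sqrt n * (1 / sqrt n) = 1 / n" using n by simp
  have ab: "a + n * b = 1 / sqrt n" using n by (simp add: b_def)
  have "n * (2 * a * b + n * b * b) = (n * b) * (2 * a + n * b)" by (simp add: algebra_simps)
  also have "\<dots> = (1 / sqrt n - a) * (1 / sqrt n + a)" by (simp flip: ab)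
  also have "\<dots> = 1 / sqrt n * (1 / sqrt n) - a * a" by (simp add: algebra_simps)
  also have "\<dots> = - 1" by (simp only: a2 s2)
  finally have q: "2 * a * b + n * b * b = - 1 / n" using n by (simp add: field_simps)
  have ee: "e \<bullet> e = n" by (simp add: e_def inner_vec_def n_def)
  have ea: "e \<bullet> axis k 1 = 1" "axis k 1 \<bullet> e = 1" for k
    by (simp_all add: e_def inner_axis inner_axis')
  have NN: "p None \<bullet> p None = 1" using s2 n by (simp add: p_def ee)
  have SN: "p (Some k) \<bullet> p None = - 1 / n" for k
  proof -
    have "p (Some k) \<bullet> p None = - (1 / sqrt n) * (a + n * b)"
      by (simp add: p_def inner_add_left ee ea algebra_simps)
    also have "\<dots> = - (1 / n)" by (simp only: ab s2 mult_minus_left)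
    finally show ?thesis by simp
  qed
  have SS: "p (Some k) \<bullet> p (Some l) = (if k = l then a * a else 0) + (2 * a * b + n * b * b)" for k l
    by (simp add: p_def inner_add_left inner_add_right inner_axis_axis ee ea algebra_simps)
  have NS: "p None \<bullet> p (Some k) = - 1 / n" for k
    by (subst inner_commute) (rule SN)
  have SS': "p (Some k) \<bullet> p (Some l) = - 1 / n" if "k \<noteq> l" for k l
    using that by (simp add: SS q)
  have "regular_simplex p"
  proof
    show "CARD('n option) = DIM(real ^ 'n) + 1" by simp
    show "norm (p i) = 1" for i
      by (cases i) (simp_all add: norm_eq_1 NN SS a2 q)
    show "p i \<bullet> p j = - 1 / real DIM(real ^ 'n)" if "i \<noteq> j" for i j
      using that by (cases i; cases j) (simp_all add: SN NS SS' n_def)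
  qed
  then show ?thesis using that by blast
qed

section \<open>The sharp bound on the quotient\<close>

lemma ratio_le:
  fixes K :: "'a::euclidean_space set"
  assumes "convex_body K" "\<not> is_singleton K"
  shows "ratio (radius K (cball 0 1)) (radius1 K (cball 0 1))
      \<le> min (ereal (sqrt (2 * real DIM('a) / (real DIM('a) + 1))))
            (2 * minkowski_asymmetry K / (minkowski_asymmetry K + 1))"
proof -
  have K: "K \<noteq> {}" "compact K" using assms by (auto simp: convex_body_def)
  obtain R where R: "0 \<le> R" "radius K (cball 0 1) = ereal R"
    using circumball_exists[OF K(2,1)] by metis
  obtain s where s: "0 \<le> s" "minkowski_asymmetry K = ereal s"
    using minkowski_asymmetry_finite[OF assms(1)] .
  have D: "0 < diameter K"
    using assms(2) K by (metis compact_imp_bounded diameter_pos ex_in_conv is_singletonI')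
  have "(2 * R / diameter K)\<^sup>2 \<le> 2 * real DIM('a) / (real DIM('a) + 1)"
    using Jung[OF K(2,1) R(2)] D by (simp add: power_divide power_mult_distrib field_simps)
  then have "2 * R / diameter K \<le> sqrt (2 * real DIM('a) / (real DIM('a) + 1))"
    by (rule real_le_rsqrt)
  moreover have "2 * R / diameter K \<le> 2 * s / (s + 1)"
    using circumradius_le_asymmetry[OF assms(1) R(2) s(2) D] .
  moreover have "2 * ereal s / (ereal s + 1) = ereal (2 * s / (s + 1))"
    using s(1) by (simp add: one_ereal_def)
  ultimately show ?thesis
    unfolding ratio_eq[OF K(2,1) D R(2)] s(2) by simp
qed

text \<open>
  The upper bound is the general one, so only an upper bound on the diameter is needed for equality.
\<close>
lemma (in regular_simplex) ratio_body:
  assumes "1 \<le> \<sigma>" "\<sigma> \<le> real DIM('a)"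
  shows "ratio (radius (body \<sigma>) (cball 0 1)) (radius1 (body \<sigma>) (cball 0 1))
      = min (ereal (sqrt (2 * real DIM('a) / (real DIM('a) + 1))))
            (2 * minkowski_asymmetry (body \<sigma>) / (minkowski_asymmetry (body \<sigma>) + 1))"
proof (rule antisym)
  show "ratio (radius (body \<sigma>) (cball 0 1)) (radius1 (body \<sigma>) (cball 0 1))
      \<le> min (ereal (sqrt (2 * real DIM('a) / (real DIM('a) + 1))))
            (2 * minkowski_asymmetry (body \<sigma>) / (minkowski_asymmetry (body \<sigma>) + 1))"
    using convex_body_body body_not_singleton assms by (intro ratio_le)
  define d where "d = real DIM('a)"
  have d: "d > 0" by (simp add: d_def)
  define m where "m = max (sqrt (2 * (d + 1) / d)) (1 + 1 / \<sigma>)"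
  have K: "body \<sigma> \<noteq> {}" "compact (body \<sigma>)"
    using convex_body_body[of \<sigma>] by (auto simp: convex_body_def)
  have D: "0 < diameter (body \<sigma>)"
    using body_not_singleton[OF assms(1)] K
    by (metis compact_imp_bounded diameter_pos ex_in_conv is_singletonI')
  have Dm: "diameter (body \<sigma>) \<le> m"
    using diameter_body_le[OF assms(1)] by (simp add: m_def d_def)
  have "sqrt (2 * d / (d + 1)) = 2 / sqrt (2 * (d + 1) / d)"
  proof -
    have "sqrt (2 * d / (d + 1)) * sqrt (2 * (d + 1) / d) = sqrt (2\<^sup>2)"
      unfolding real_sqrt_mult[symmetric] using d by (intro arg_cong[of _ _ sqrt]) (simp add: divide_simps)
    then show ?thesis using d by (simp add: field_simps)
  qed
  moreover have "2 * \<sigma> / (\<sigma> + 1) = 2 / (1 + 1 / \<sigma>)"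
    using assms by (simp add: field_simps)
  ultimately have "min (sqrt (2 * d / (d + 1))) (2 * \<sigma> / (\<sigma> + 1)) \<le> 2 / m"
    by (simp add: m_def max_def min_def)
  also have "2 / m \<le> 2 * 1 / diameter (body \<sigma>)"
    using D Dm by (simp add: frac_le)
  finally have "min (sqrt (2 * d / (d + 1))) (2 * \<sigma> / (\<sigma> + 1)) \<le> 2 * 1 / diameter (body \<sigma>)" .
  moreover have "2 * ereal \<sigma> / (ereal \<sigma> + 1) = ereal (2 * \<sigma> / (\<sigma> + 1))"
    using assms by (simp add: one_ereal_def)
  ultimately show "min (ereal (sqrt (2 * real DIM('a) / (real DIM('a) + 1))))
            (2 * minkowski_asymmetry (body \<sigma>) / (minkowski_asymmetry (body \<sigma>) + 1))
      \<le> ratio (radius (body \<sigma>) (cball 0 1)) (radius1 (body \<sigma>) (cball 0 1))"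
    unfolding ratio_eq[OF K(2,1) D circumradius_body[OF assms(1)]] asymmetry_body[OF assms] d_def
    by (simp add: min_le_iff_disj)
qed

theorem theorem5p1:
  shows "(\<forall>K :: (real ^ 'n) set. convex_body K \<and> \<not> is_singleton K \<longrightarrow>
            ratio (radius K (cball 0 1)) (radius1 K (cball 0 1))
              \<le> min (ereal (sqrt (2 * real CARD('n) / (real CARD('n) + 1))))
                    (2 * minkowski_asymmetry K / (minkowski_asymmetry K + 1))) \<and>
         (\<forall>\<sigma> :: real. 1 \<le> \<sigma> \<and> \<sigma> \<le> real CARD('n) \<longrightarrow>
            (\<exists>K :: (real ^ 'n) set. convex_body K \<and> minkowski_asymmetry K = ereal \<sigma> \<and>
               ratio (radius K (cball 0 1)) (radius1 K (cball 0 1))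
                 = min (ereal (sqrt (2 * real CARD('n) / (real CARD('n) + 1))))
                       (2 * minkowski_asymmetry K / (minkowski_asymmetry K + 1))))"
proof (intro conjI allI impI)
  fix K :: "(real ^ 'n) set"
  assume "convex_body K \<and> \<not> is_singleton K"
  then show "ratio (radius K (cball 0 1)) (radius1 K (cball 0 1))
      \<le> min (ereal (sqrt (2 * real CARD('n) / (real CARD('n) + 1))))
            (2 * minkowski_asymmetry K / (minkowski_asymmetry K + 1))"
    using ratio_le[of K] by simp
next
  fix \<sigma> :: real
  assume \<sigma>: "1 \<le> \<sigma> \<and> \<sigma> \<le> real CARD('n)"
  obtain p :: "'n option \<Rightarrow> real ^ 'n" where "regular_simplex p"
    by (rule regular_simplex_exists)
  then interpret regular_simplex p .
  show "\<exists>K :: (real ^ 'n) set. convex_body K \<and> minkowski_asymmetry K = ereal \<sigma> \<and>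
      ratio (radius K (cball 0 1)) (radius1 K (cball 0 1))
        = min (ereal (sqrt (2 * real CARD('n) / (real CARD('n) + 1))))
              (2 * minkowski_asymmetry K / (minkowski_asymmetry K + 1))"
    using convex_body_body[of \<sigma>] asymmetry_body[of \<sigma>] ratio_body[of \<sigma>] \<sigma>
    by (intro exI[of _ "body \<sigma>"]) simp
qed

end
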